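(* For any finite, simple, connected, undirected graphs $G$ and $H$ such that $\gamma(G)=3$, $$\gamma(G\,\square\, H)\geq \gamma(G)\,\gamma(H).$$
   Context: All graphs are finite, simple, connected and undirected (with nonempty vertex set). For a graph $G$ and $v\in V(G)$, $N[v]$ denotes the closed neighborhood of $v$ (that is, $v$ together with all its neighbors), and $N[S]=\bigcup_{v\in S}N[v]$ for $S\subseteq V(G)$. A set $S\subseteq V(G)$ dominates $G$ if $N[S]=V(G)$. The domination number $\gamma(G)$ is the minimum cardinality of a set that dominates $G$. The Cartesian product $G\,\square\,H$ is the graph with vertex set $V(G)\times V(H)$ in which $(u_1,v_1)$ and $(u_2,v_2)$ are adjacent if and only if either $v_1=v_2$ and $u_1u_2\in E(G)$, or $u_1=u_2$ and $v_1v_2\in E(H)$. *)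

theory Defs
  imports "Graph_Theory.Digraph_Component"
begin

text \<open>
  Finite simple undirected graphs are those of the locale \<^locale>\<open>pair_graph\<close>: finite loop-free
  digraphs whose arcs are pairs of vertices forming a symmetric relation, an edge
  \<open>uv\<close> being the two arcs \<open>(u, v)\<close> and \<open>(v, u)\<close>. The library's \<^const>\<open>connected\<close>
  already requires a nonempty vertex set.
\<close>

definition closed_nbhd :: "'a pair_pre_digraph \<Rightarrow> 'a \<Rightarrow> 'a set" where
  "closed_nbhd G v = insert v {u. (v, u) \<in> parcs G}"

definition dominating :: "'a pair_pre_digraph \<Rightarrow> 'a set \<Rightarrow> bool" where
  "dominating G S \<longleftrightarrow> S \<subseteq> pverts G \<and> (\<Union>v\<in>S. closed_nbhd G v) = pverts G"

definition domination_number :: "'a pair_pre_digraph \<Rightarrow> nat" where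
  "domination_number G = (LEAST n. \<exists>S. dominating G S \<and> card S = n)"

definition cartesian_product ::
    "'a pair_pre_digraph \<Rightarrow> 'b pair_pre_digraph \<Rightarrow> ('a \<times> 'b) pair_pre_digraph" where
  "cartesian_product G H =
     \<lparr> pverts = pverts G \<times> pverts H,
       parcs = {((u1, v1), (u2, v2)) | u1 v1 u2 v2.
          (v1 = v2 \<and> v1 \<in> pverts H \<and> (u1, u2) \<in> parcs G) \<or>
          (u1 = u2 \<and> u1 \<in> pverts G \<and> (v1, v2) \<in> parcs H)} \<rparr>"

lemma (in pair_graph) dominating_pverts: "dominating G (pverts G)"
  by (auto simp: dominating_def closed_nbhd_def in_arcsD2)

lemma (in pair_graph) domination_number_attained:
  "\<exists>S. dominating G S \<and> card S = domination_number G"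
  unfolding domination_number_def
  by (rule LeastI_ex) (use dominating_pverts in blast)

lemma domination_number_le: "dominating G S \<Longrightarrow> domination_number G \<le> card S"
  unfolding domination_number_def by (rule Least_le) blast

lemma pair_graph_cartesian_product:
  assumes "pair_graph G" "pair_graph H"
  shows "pair_graph (cartesian_product G H)"
proof -
  interpret G: pair_graph G by fact
  interpret H: pair_graph H by fact
  let ?P = "cartesian_product G H"
  have sub: "parcs ?P \<subseteq> pverts ?P \<times> pverts ?P"
    by (auto simp: cartesian_product_def G.in_arcsD1 G.in_arcsD2 H.in_arcsD1 H.in_arcsD2)
  have fin: "finite (pverts ?P)"
    by (simp add: cartesian_product_def)
  show ?thesis
  proof
    show "finite (parcs ?P)"
      using sub fin by (meson finite_SigmaI finite_subset)
    show "symmetric ?P"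
      unfolding symmetric_def
      by (auto simp: cartesian_product_def intro!: symI dest: G.arcs_symmetric H.arcs_symmetric)
    show "fst e \<in> pverts ?P" "snd e \<in> pverts ?P" if "e \<in> parcs ?P" for e
      using sub that by (auto simp: mem_Times_iff)
  qed (use fin in \<open>auto simp: cartesian_product_def dest: G.no_loops H.no_loops\<close>)
qed

end

theory Submission
  imports Defs
begin

text \<open>
  Call distinct non-adjacent vertices of \<open>G\<close> \<open>Q\<close>-adjacent. Since no two vertices dominate \<open>G\<close>, any
  two vertices have a common \<open>Q\<close>-neighbour. For a dominating set \<open>F\<close> of the product, let \<open>D h\<close> be its
  fibre over \<open>h\<close>; every common \<open>Q\<close>-neighbour of \<open>D h\<close> then lies in \<open>D k\<close> for some neighbour \<open>k\<close> of
  \<open>h\<close>. It suffices to give each \<open>h\<close> a set \<open>L h\<close> of the labels 1, 2, 3, with total size at most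
  \<open>card F\<close>, such that every closed neighbourhood in \<open>H\<close> carries all three labels.

  A 3-colouring of \<open>G\<close> in which every closed \<open>Q\<close>-neighbourhood meets all colours labels the
  one-element fibres. It is built around a hub \<open>b\<close> of minimal \<open>Q\<close>-degree, using maximal
  \<open>Q\<close>-independent sets. Two-element fibres have room for two labels and nearly all of them get 1 and
  2; those seeing no label 3 of the colouring are served by a maximal independent set \<open>R\<close> of such
  \<open>h\<close>. The few pairs left over (\<open>\<Lambda>\<close>) get the labels 1 and 3, and can only deprive some empty fibres of
  the label 2. Each of these has at least two neighbours in \<open>\<Lambda>\<close>, so moving the labels 1 and 3 from
  these neighbours to the empty fibre, for a maximal family with disjoint neighbourhoods in \<open>\<Lambda>\<close>,
  costs nothing.
\<close>

section \<open>Roles of the vertices of \<open>G\<close>\<close>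

text \<open>Greedy insertion of one element at a time. Independence concerns distinct elements only,
  so the relation may be reflexive, as overlap of neighbourhoods is.\<close>

lemma maximal_independent_subset:
  assumes "finite B" and sym: "\<And>x y. A x y \<Longrightarrow> A y x"
  obtains R where "R \<subseteq> B" "\<And>x y. \<lbrakk>x \<in> R; y \<in> R; x \<noteq> y\<rbrakk> \<Longrightarrow> \<not> A x y"
    "\<And>x. \<lbrakk>x \<in> B; x \<notin> R\<rbrakk> \<Longrightarrow> \<exists>y\<in>R. A x y"
proof -
  have "\<exists>R\<subseteq>B. (\<forall>x\<in>R. \<forall>y\<in>R. x \<noteq> y \<longrightarrow> \<not> A x y) \<and> (\<forall>x\<in>B - R. \<exists>y\<in>R. A x y)"
    using \<open>finite B\<close>
  proof (induction B rule: finite_induct)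
    case (insert x B)
    then obtain R where R: "R \<subseteq> B" "\<forall>x\<in>R. \<forall>y\<in>R. x \<noteq> y \<longrightarrow> \<not> A x y"
        "\<forall>x\<in>B - R. \<exists>y\<in>R. A x y"
      by blast
    show ?case
    proof (cases "\<exists>y\<in>R. A x y")
      case True
      then show ?thesis using R by (intro exI[of _ R]) auto
    next
      case False
      then show ?thesis using R sym by (intro exI[of _ "insert x R"]) blast
    qed
  qed auto
  then show thesis using that by (metis DiffI)
qed

text \<open>
  The colour classes are 1: \<open>X\<close>, \<open>NY\<close>; 2: \<open>Y\<close>, \<open>NX\<close>; 3: \<open>Hub\<close>, \<open>T\<close>. The \<open>Q\<close>-neighbours of the hub
  are the vertices of role \<open>X\<close> or \<open>Y\<close>.
\<close>

datatype role = Hub | X | Y | T | NX | NY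

text \<open>The existence conditions make every closed \<open>Q\<close>-neighbourhood meet all three
  colours; \<open>X_indep\<close>, \<open>NX_Y\<close> and \<open>NY_X\<close> serve the two-element
  fibres.\<close>

locale roles =
  fixes V :: "'a set" and Q :: "'a \<Rightarrow> 'a \<Rightarrow> bool" and b :: 'a and r :: "'a \<Rightarrow> role"
  assumes Q_sym: "Q u v \<Longrightarrow> Q v u"
    and Q_irrefl: "\<not> Q u u"
    and common: "\<lbrakk>u \<in> V; v \<in> V\<rbrakk> \<Longrightarrow> \<exists>w\<in>V. Q u w \<and> Q v w"
    and hub_in: "b \<in> V"
    and hub: "v \<in> V \<Longrightarrow> r v = Hub \<longleftrightarrow> v = b"
    and hub_adj: "v \<in> V \<Longrightarrow> Q b v \<longleftrightarrow> r v = X \<or> r v = Y"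
    and X_indep: "\<lbrakk>u \<in> V; v \<in> V; r u = X; r v = X\<rbrakk> \<Longrightarrow> \<not> Q u v"
    and X_Y: "\<lbrakk>v \<in> V; r v = X\<rbrakk> \<Longrightarrow> \<exists>u\<in>V. Q v u \<and> r u = Y"
    and Y_X: "\<lbrakk>v \<in> V; r v = Y\<rbrakk> \<Longrightarrow> \<exists>u\<in>V. Q v u \<and> r u = X"
    and T_1: "\<lbrakk>v \<in> V; r v = T\<rbrakk> \<Longrightarrow> \<exists>u\<in>V. Q v u \<and> (r u = X \<or> r u = NY)"
    and T_2: "\<lbrakk>v \<in> V; r v = T\<rbrakk> \<Longrightarrow> \<exists>u\<in>V. Q v u \<and> (r u = Y \<or> r u = NX)"
    and NX_X: "\<lbrakk>v \<in> V; r v = NX\<rbrakk> \<Longrightarrow> \<exists>u\<in>V. Q v u \<and> r u = X"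
    and NX_Y: "\<lbrakk>v \<in> V; r v = NX; u \<in> V; r u = Y\<rbrakk> \<Longrightarrow> \<not> Q v u"
    and NX_T: "\<lbrakk>v \<in> V; r v = NX\<rbrakk> \<Longrightarrow> \<exists>u\<in>V. Q v u \<and> r u = T"
    and NY_Y: "\<lbrakk>v \<in> V; r v = NY\<rbrakk> \<Longrightarrow> \<exists>u\<in>V. Q v u \<and> r u = Y"
    and NY_X: "\<lbrakk>v \<in> V; r v = NY; u \<in> V; r u = X\<rbrakk> \<Longrightarrow> \<not> Q v u"
    and NY_T: "\<lbrakk>v \<in> V; r v = NY\<rbrakk> \<Longrightarrow> \<exists>u\<in>V. Q v u \<and> r u = T"

text \<open>The \<open>Q\<close>-neighbourhood \<open>W\<close> of \<open>b\<close> splits into a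
  maximal independent set (\<open>X\<close>) and the rest (\<open>Y\<close>). \<open>NX\<close> and
  \<open>NY\<close> are maximal independent among the outer vertices whose
  \<open>Q\<close>-neighbours in \<open>W\<close> are all \<open>X\<close>, respectively all
  \<open>Y\<close>; what remains is \<open>T\<close>.\<close>

lemma roles_exist:
  fixes V :: "'a set"
  assumes fin: "finite V" and ne: "V \<noteq> {}"
    and sym: "\<And>u v. Q u v \<Longrightarrow> Q v u"
    and irrefl: "\<And>u. \<not> Q u u"
    and common: "\<And>u v. \<lbrakk>u \<in> V; v \<in> V\<rbrakk> \<Longrightarrow> \<exists>w\<in>V. Q u w \<and> Q v w"
  obtains b r where "roles V Q b r"
proof -
  define N where "N u = {v\<in>V. Q u v}" for u
  obtain b where b: "b \<in> V" "\<And>v. v \<in> V \<Longrightarrow> card (N b) \<le> card (N v)"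
    using ex_min_if_finite[of "(\<lambda>v. card (N v)) ` V"] fin ne
    by (metis (no_types, lifting) arg_min_least arg_min_if_finite(1))
  define W where "W = N b"
  have finN: "finite (N u)" for u using fin by (simp add: N_def)
  have WV: "W \<subseteq> V" "b \<notin> W" using irrefl by (auto simp: W_def N_def)
  \<comment> \<open>Minimality of \<open>b\<close> is what rules out a vertex outside \<open>W\<close> with all its \<open>Q\<close>-neighbours in \<open>Ys\<close>.\<close>
  have Wmin: "N z = W" if "z \<in> V" "N z \<subseteq> W" for z
    using that b(2) finN card_seteq unfolding W_def by metis
  obtain Xs where Xs: "Xs \<subseteq> W" "\<And>x y. \<lbrakk>x \<in> Xs; y \<in> Xs\<rbrakk> \<Longrightarrow> \<not> Q x y"
      "\<And>x. \<lbrakk>x \<in> W; x \<notin> Xs\<rbrakk> \<Longrightarrow> \<exists>y\<in>Xs. Q x y"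
    using maximal_independent_subset[of W Q] sym irrefl finN unfolding W_def by metis
  define Ys where "Ys = W - Xs"
  have meetsW: "\<exists>w\<in>W. Q z w" if "z \<in> V" for z
    using common[OF that b(1)] by (auto simp: W_def N_def)
  define Z1 where "Z1 = {z \<in> V - insert b W. N z \<inter> W \<subseteq> Xs}"
  define Z2 where "Z2 = {z \<in> V - insert b W. N z \<inter> W \<subseteq> Ys}"
  have disj: "Z1 \<inter> Z2 = {}"
    using meetsW WV unfolding Z1_def Z2_def Ys_def N_def by blast
  have "finite Z1" "finite Z2" using fin by (auto simp: Z1_def Z2_def)
  obtain N1 where N1: "N1 \<subseteq> Z1" "\<And>x y. \<lbrakk>x \<in> N1; y \<in> N1\<rbrakk> \<Longrightarrow> \<not> Q x y"
      "\<And>x. \<lbrakk>x \<in> Z1; x \<notin> N1\<rbrakk> \<Longrightarrow> \<exists>y\<in>N1. Q x y"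
    using maximal_independent_subset[of Z1 Q] sym irrefl \<open>finite Z1\<close> by metis
  obtain N2 where N2: "N2 \<subseteq> Z2" "\<And>x y. \<lbrakk>x \<in> N2; y \<in> N2\<rbrakk> \<Longrightarrow> \<not> Q x y"
      "\<And>x. \<lbrakk>x \<in> Z2; x \<notin> N2\<rbrakk> \<Longrightarrow> \<exists>y\<in>N2. Q x y"
    using maximal_independent_subset[of Z2 Q] sym irrefl \<open>finite Z2\<close> by metis
  define r where "r v = (if v = b then Hub else if v \<in> Xs then X else if v \<in> Ys then Y
     else if v \<in> N1 then NX else if v \<in> N2 then NY else T)" for v
  have Z: "z \<noteq> b \<and> z \<notin> W \<and> z \<in> V" if "z \<in> Z1 \<union> Z2" for z
    using that by (auto simp: Z1_def Z2_def)
  have rX: "r v = X \<longleftrightarrow> v \<in> Xs" for v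
    using WV Xs(1) by (auto simp: r_def)
  have rY: "r v = Y \<longleftrightarrow> v \<in> Ys" for v
    using WV by (auto simp: r_def Ys_def)
  have rNX: "r v = NX \<longleftrightarrow> v \<in> N1" for v
    using N1(1) Z Xs(1) by (auto simp: r_def Ys_def)
  have rNY: "r v = NY \<longleftrightarrow> v \<in> N2" for v
    using N1(1) N2(1) Z Xs(1) disj by (auto simp: r_def Ys_def)
  have rT: "r v = T \<longleftrightarrow> v \<noteq> b \<and> v \<notin> W \<and> v \<notin> N1 \<and> v \<notin> N2" for v
    using Xs(1) by (auto simp: r_def Ys_def)
  have W: "v \<in> W \<longleftrightarrow> v \<in> V \<and> Q b v" for v
    by (auto simp: W_def N_def)
  have Z1D: "u \<in> Xs" if "z \<in> Z1" "u \<in> W" "Q z u" for z u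
    using that W by (auto simp: Z1_def N_def)
  have Z2D: "u \<in> Ys" if "z \<in> Z2" "u \<in> W" "Q z u" for z u
    using that W by (auto simp: Z2_def N_def)
  have N1V: "N1 \<subseteq> V" "N2 \<subseteq> V" using N1 N2 Z by auto
  have noT1: "v \<in> Z1" if "v \<in> V" "v \<noteq> b" "v \<notin> W" "\<And>y. y \<in> Ys \<Longrightarrow> \<not> Q v y" for v
    using that unfolding Z1_def N_def Ys_def by blast
  have noT2: "v \<in> Z2" if "v \<in> V" "v \<noteq> b" "v \<notin> W" "\<And>y. y \<in> Xs \<Longrightarrow> \<not> Q v y" for v
    using that unfolding Z2_def N_def Ys_def by blast
  have "roles V Q b r"
  proof
    show "r v = Hub \<longleftrightarrow> v = b" for v by (auto simp: r_def)
    show "Q b v \<longleftrightarrow> r v = X \<or> r v = Y" if "v \<in> V" for v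
      using that Xs(1) unfolding rX rY Ys_def using W by blast
    show "\<not> Q u v" if "r u = X" "r v = X" for u v
      using that Xs(2) unfolding rX by blast
    show "\<exists>u\<in>V. Q v u \<and> r u = Y" if v: "v \<in> V" "r v = X" for v
    proof -
      obtain u where "u \<in> W" "Q v u" using meetsW v by blast
      then have "u \<in> Ys" using v Xs(2) by (auto simp: Ys_def rX)
      then show ?thesis using \<open>Q v u\<close> \<open>u \<in> W\<close> rY WV by blast
    qed
    show "\<exists>u\<in>V. Q v u \<and> r u = X" if v: "v \<in> V" "r v = Y" for v
      using Xs v WV unfolding rX rY Ys_def by blast
    show "\<exists>u\<in>V. Q v u \<and> (r u = X \<or> r u = NY)" if v: "v \<in> V" "r v = T" for v
      using noT2[of v] N2(3)[of v] v N1V Xs(1) WV unfolding rX rNY rT by blast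
    show "\<exists>u\<in>V. Q v u \<and> (r u = Y \<or> r u = NX)" if v: "v \<in> V" "r v = T" for v
      using noT1[of v] N1(3)[of v] v N1V WV unfolding rY rNX rT Ys_def by blast
    show "\<exists>u\<in>V. Q v u \<and> r u = X" if v: "v \<in> V" "r v = NX" for v
      using meetsW[OF v(1)] Z1D[of v] v N1(1) WV unfolding rX rNX by blast
    show "\<exists>u\<in>V. Q v u \<and> r u = Y" if v: "v \<in> V" "r v = NY" for v
      using meetsW[OF v(1)] Z2D[of v] v N2(1) WV unfolding rY rNY by blast
    show NXY: "\<not> Q v u" if "r v = NX" "r u = Y" for u v
      using that Z1D[of v u] N1(1) unfolding rY rNX Ys_def by blast
    show "\<not> Q v u" if "r v = NY" "r u = X" for u v
      using that Z2D[of v u] N2(1) Xs(1) unfolding rX rNY Ys_def by blast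
    show "\<exists>u\<in>V. Q v u \<and> r u = T" if v: "v \<in> V" "r v = NX" for v
    proof -
      have vN: "v \<in> N1" using v rNX by blast
      obtain w where w: "w \<in> W" "Q v w" using meetsW v(1) by blast
      then have wX: "w \<in> Xs" using Z1D vN N1(1) by blast
      \<comment> \<open>This common \<open>Q\<close>-neighbour has role \<open>T\<close>: each other
        role contradicts an independence or the choice of \<open>Z1\<close> and
        \<open>Z2\<close>.\<close>
      obtain u where u: "u \<in> V" "Q v u" "Q w u" using common v(1) w WV by blast
      have "u \<noteq> b" using vN N1(1) Z u(2) sym W by blast
      moreover have "u \<notin> W"
        using Z1D[of v u] Xs(2) wX u vN N1(1) by blast
      moreover have "u \<notin> N1" using N1(2) vN u by blast
      moreover have "u \<notin> N2" using Z2D[of u w] N2(1) w(1) wX u(3) sym unfolding Ys_def by blast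
      ultimately show ?thesis using u rT by blast
    qed
    show "\<exists>u\<in>V. Q v u \<and> r u = T" if v: "v \<in> V" "r v = NY" for v
    proof (rule ccontr)
      \<comment> \<open>\<open>Ys\<close> need not be independent, so the argument for
        \<open>NX\<close> does not carry over. Minimal degree gives \<open>v\<close> a
        \<open>Q\<close>-neighbour in \<open>N1\<close> instead, and a common
        \<open>Q\<close>-neighbour of the two has no role left.\<close>
      assume no: "\<not> ?thesis"
      have vN: "v \<in> N2" using v rNY by blast
      have vb: "\<not> Q v b" using vN N2(1) Z sym W by blast
      have sub: "u \<in> W \<or> u \<in> N1" if "u \<in> V" "Q v u" for u
        using that no vb vN N2(2) rT by blast
      have "\<not> N v \<subseteq> W"
      proof
        assume "N v \<subseteq> W"
        then have eq: "N v = W" using Wmin v(1) by blast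
        have "Xs \<noteq> {}" using meetsW[OF b(1)] Xs(3) by blast
        then obtain x where "x \<in> Xs" by blast
        then show False using eq Z2D[of v x] vN N2(1) Xs(1) unfolding N_def Ys_def by blast
      qed
      then obtain u where u: "u \<in> V" "Q v u" "u \<in> N1"
        using sub unfolding N_def by blast
      obtain t where t: "t \<in> V" "Q v t" "Q u t" using common u(1) v(1) by blast
      have "t \<notin> W" using Z2D[of v t] Z1D[of u t] vN u(3) N1(1) N2(1) t unfolding Ys_def by blast
      moreover have "t \<notin> N1" using N1(2) u(3) t(3) by blast
      ultimately show False using sub t by blast
    qed
  qed (use sym irrefl common b in auto)
  then show thesis by (rule that)
qed

section \<open>Labelling the fibres\<close>

text \<open>\<open>sees\<close> says that a vertex \<open>(u, h)\<close> not dominated inside its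
  own copy of \<open>G\<close> is dominated along an edge of \<open>H\<close>.\<close>

locale role_product = roles V Q b r for V :: "'a set" and Q b r +
  fixes U :: "'h set" and A :: "'h \<Rightarrow> 'h \<Rightarrow> bool" and D :: "'h \<Rightarrow> 'a set"
  assumes finU: "finite U"
    and finD: "finite (D h)"
    and D_sub: "D h \<subseteq> V"
    and A_U: "A h k \<Longrightarrow> h \<in> U"
    and A_sym: "A h k \<Longrightarrow> A k h"
    and A_irrefl: "\<not> A h h"
    and sees: "\<lbrakk>h \<in> U; u \<in> V; \<And>d. d \<in> D h \<Longrightarrow> Q d u\<rbrakk> \<Longrightarrow> \<exists>k. A h k \<and> u \<in> D k"
begin

lemma A_U2: "A h k \<Longrightarrow> k \<in> U"
  using A_U A_sym by blast

section \<open>Access to the label 3, and the initial labelling\<close>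

text \<open>The fibres that carry 3 from the outset: three vertices have room for all labels, and
  the hub and \<open>T\<close> have colour 3.\<close>

definition S :: "'h set" where
  "S = {h\<in>U. 3 \<le> card (D h) \<or> b \<in> D h \<or> (\<exists>t. D h = {t} \<and> r t = T)}"

text \<open>Empty fibres are left out because they see the hub in any case.\<close>

definition Bad :: "'h set" where
  "Bad = {h\<in>U. D h \<noteq> {} \<and> h \<notin> S \<and> (\<forall>k. A h k \<longrightarrow> k \<notin> S)}"

text \<open>Under \<open>L0\<close> the neighbours never supply 1, and a fibre holding a
  \<open>Y\<close> should carry 2; membership in \<open>R\<close> would demand 3 as well, one label
  too many for a pair.\<close>

definition Stuck :: "'h set" where
  "Stuck = {h\<in>Bad. card (D h) = 2 \<and> (\<exists>y\<in>D h. r y = Y) \<and>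
     (\<forall>k. A h k \<longrightarrow> D k = {} \<or> (\<exists>v. D k = {v} \<and> (r v = Y \<or> r v = NX)))}"

text \<open>
  Stuck fibres are kept out of \<open>R\<close> so that nobody but themselves depends on them for the label 3.
\<close>

definition R :: "'h set" where
  "R = (SOME R. R \<subseteq> Bad - Stuck \<and> (\<forall>h\<in>R. \<forall>k\<in>R. \<not> A h k) \<and>
      (\<forall>h\<in>Bad - Stuck - R. \<exists>k\<in>R. A h k))"

definition \<Lambda> :: "'h set" where
  "\<Lambda> = {h\<in>Stuck. \<forall>k\<in>R. \<not> A h k}"

text \<open>For \<open>h\<close> in \<open>R\<close> this means that some neighbour carries 1 under
  \<open>L0\<close>; it is phrased by fibres because \<open>L0\<close> depends on it.\<close>

definition seen1 :: "'h \<Rightarrow> bool" where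
  "seen1 h \<longleftrightarrow> (\<exists>k. A h k \<and> (card (D k) = 2 \<or> (\<exists>v. D k = {v} \<and> (r v = X \<or> r v = NY))))"

fun colour :: "role \<Rightarrow> nat" where
  "colour Hub = 3" | "colour X = 1" | "colour Y = 2" | "colour T = 3" | "colour NX = 2" | "colour NY = 1"

text \<open>A pair that is in \<open>R\<close> or contains the hub spends one label on 3; the tests
  choose the other so that the neighbours supply the missing one.\<close>

definition L0 :: "'h \<Rightarrow> nat set" where
  "L0 h =
    (if 3 \<le> card (D h) then {1, 2, 3}
     else if D h = {} then {}
     else if h \<in> \<Lambda> then {1, 3}
     else if card (D h) = 1 then
       (if h \<in> R then {3} else {colour (r (the_elem (D h)))})
     else if h \<in> R then (if (\<exists>x\<in>D h. r x = X) \<or> \<not> seen1 h then {1, 3} else {2, 3})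
     else if b \<in> D h then
       (if (\<exists>x\<in>D h. r x = X) \<or> (\<forall>v\<in>D h - {b}. r v \<noteq> Y \<and> (\<forall>x\<in>V. r x = X \<longrightarrow> \<not> Q v x))
        then {1, 3} else {2, 3})
     else {1, 2})"

section \<open>Structure of the bad fibres\<close>

lemma R_props:
  shows R_sub: "R \<subseteq> Bad - Stuck"
    and R_indep: "\<lbrakk>h \<in> R; k \<in> R\<rbrakk> \<Longrightarrow> \<not> A h k"
    and R_dom: "\<lbrakk>h \<in> Bad; h \<notin> Stuck; h \<notin> R\<rbrakk> \<Longrightarrow> \<exists>k\<in>R. A h k"
proof -
  have "finite (Bad - Stuck)" using finU by (auto simp: Bad_def)
  then obtain R' where "R' \<subseteq> Bad - Stuck" "\<And>x y. \<lbrakk>x \<in> R'; y \<in> R'; x \<noteq> y\<rbrakk> \<Longrightarrow> \<not> A x y"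
      "\<And>x. \<lbrakk>x \<in> Bad - Stuck; x \<notin> R'\<rbrakk> \<Longrightarrow> \<exists>y\<in>R'. A x y"
    using maximal_independent_subset[of "Bad - Stuck" A] A_sym by metis
  then have "\<exists>R. R \<subseteq> Bad - Stuck \<and> (\<forall>h\<in>R. \<forall>k\<in>R. \<not> A h k) \<and>
      (\<forall>h\<in>Bad - Stuck - R. \<exists>k\<in>R. A h k)"
    using A_irrefl by (intro exI[of _ R']) blast
  from someI_ex[OF this]
  have *: "R \<subseteq> Bad - Stuck" "\<forall>h\<in>R. \<forall>k\<in>R. \<not> A h k" "\<forall>h\<in>Bad - Stuck - R. \<exists>k\<in>R. A h k"
    unfolding R_def by blast+
  show "R \<subseteq> Bad - Stuck" by (rule *)
  show "\<not> A h k" if "h \<in> R" "k \<in> R" using * that by blast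
  show "\<exists>k\<in>R. A h k" if "h \<in> Bad" "h \<notin> Stuck" "h \<notin> R" using * that by blast
qed

lemma Lam_Stuck: "\<Lambda> \<subseteq> Stuck" and Lam_R: "\<lbrakk>h \<in> \<Lambda>; k \<in> R\<rbrakk> \<Longrightarrow> \<not> A h k"
  by (auto simp: \<Lambda>_def)

lemma Stuck_Bad: "Stuck \<subseteq> Bad" by (auto simp: Stuck_def)

lemma Bad_U: "Bad \<subseteq> U" by (auto simp: Bad_def)

lemma Lam_Bad: "\<Lambda> \<subseteq> Bad" using Lam_Stuck Stuck_Bad by blast

lemma R_Bad: "R \<subseteq> Bad" using R_sub by blast

lemma R_Lam: "R \<inter> \<Lambda> = {}" using R_sub Lam_Stuck by blast

lemma Bad_nbr: "\<lbrakk>h \<in> Bad; A h k\<rbrakk> \<Longrightarrow> k \<notin> S"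
  by (auto simp: Bad_def)

lemma Bad_not_S: "h \<in> Bad \<Longrightarrow> h \<notin> S"
  by (auto simp: Bad_def)

lemma hub_S: "\<lbrakk>h \<in> U; b \<in> D h\<rbrakk> \<Longrightarrow> h \<in> S"
  by (auto simp: S_def)

text \<open>Otherwise the hub would occur in a neighbouring fibre, which then lies in
  \<open>S\<close>.\<close>

lemma Bad_hub:
  assumes "h \<in> Bad"
  shows "\<exists>d\<in>D h. \<not> Q d b"
proof (rule ccontr)
  assume "\<not> ?thesis"
  then obtain k where k: "A h k" "b \<in> D k"
    using sees[of h b] hub_in Bad_U assms by blast
  then show False using Bad_nbr[OF assms] hub_S[OF A_U2] by blast
qed

lemma size_cases:
  obtains "D h = {}" | v where "D h = {v}" | "card (D h) = 2" | "3 \<le> card (D h)"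
proof -
  have "card (D h) = 0 \<or> card (D h) = 1 \<or> card (D h) = 2 \<or> 3 \<le> card (D h)" by linarith
  then show thesis using that finD by (metis card_0_eq card_1_singletonE)
qed

text \<open>A single \<open>Hub\<close> or \<open>T\<close> lies in \<open>S\<close>;
  \<open>X\<close> and \<open>Y\<close> are \<open>Q\<close>-adjacent to the hub, against
  \<open>Bad_hub\<close>.\<close>

lemma Bad_pair_or_single:
  assumes "h \<in> Bad"
  obtains v where "D h = {v}" "r v = NX \<or> r v = NY" | "card (D h) = 2"
proof (cases rule: size_cases[of h])
  case (2 v)
  have h: "h \<in> U" "h \<notin> S" using assms by (auto simp: Bad_def)
  have v: "v \<in> V" using 2 D_sub by blast
  have "r v \<noteq> Hub" using hub h hub_S 2 v by blast
  moreover have "r v \<noteq> T" using h 2 by (auto simp: S_def)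
  moreover have "\<not> Q v b"
    using Bad_hub[OF assms] 2 by auto
  then have "r v \<noteq> X" "r v \<noteq> Y" using hub_adj[OF v] Q_sym by blast+
  ultimately show thesis using that(1)[OF 2] by (cases "r v") auto
qed (use assms that in \<open>auto simp: Bad_def S_def\<close>)

lemma Bad_single:
  assumes "h \<in> Bad" "D h = {v}"
  shows "r v = NX \<or> r v = NY"
  by (rule Bad_pair_or_single[OF assms(1)]) (use assms(2) in auto)

lemma Lam_card: "h \<in> \<Lambda> \<Longrightarrow> card (D h) = 2"
  using Lam_Stuck by (auto simp: Stuck_def)

section \<open>Values of the initial labelling\<close>

lemma L0_big: "3 \<le> card (D h) \<Longrightarrow> L0 h = {1, 2, 3}"
  by (simp add: L0_def)

lemma L0_empty: "D h = {} \<Longrightarrow> L0 h = {}"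
  by (simp add: L0_def)

lemma L0_Lam:
  assumes "h \<in> \<Lambda>"
  shows "L0 h = {1, 3}"
proof -
  have "D h \<noteq> {}" using Lam_card[OF assms] by auto
  then show ?thesis using Lam_card[OF assms] assms by (simp add: L0_def)
qed

lemma L0_R_single: "\<lbrakk>D h = {v}; h \<in> R\<rbrakk> \<Longrightarrow> L0 h = {3}"
  using Lam_card[of h] by (cases "h \<in> \<Lambda>") (simp_all add: L0_def)

lemma L0_single: "\<lbrakk>D h = {v}; h \<notin> R\<rbrakk> \<Longrightarrow> L0 h = {colour (r v)}"
  using Lam_card[of h] by (cases "h \<in> \<Lambda>") (simp_all add: L0_def)

lemma L0_pair:
  assumes "card (D h) = 2" "h \<notin> \<Lambda>"
  shows L0_R_pair: "h \<in> R \<Longrightarrow>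
      L0 h = (if (\<exists>x\<in>D h. r x = X) \<or> \<not> seen1 h then {1, 3} else {2, 3})"
    and L0_full: "\<lbrakk>h \<notin> R; b \<notin> D h\<rbrakk> \<Longrightarrow> L0 h = {1, 2}"
    and L0_hub: "\<lbrakk>h \<notin> R; b \<in> D h\<rbrakk> \<Longrightarrow> L0 h =
      (if (\<exists>x\<in>D h. r x = X) \<or> (\<forall>v\<in>D h - {b}. r v \<noteq> Y \<and> (\<forall>x\<in>V. r x = X \<longrightarrow> \<not> Q v x))
       then {1, 3} else {2, 3})"
proof -
  have "D h \<noteq> {}" using assms by auto
  then show
    "h \<in> R \<Longrightarrow> L0 h = (if (\<exists>x\<in>D h. r x = X) \<or> \<not> seen1 h then {1, 3} else {2, 3})"
    "\<lbrakk>h \<notin> R; b \<notin> D h\<rbrakk> \<Longrightarrow> L0 h = {1, 2}"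
    "\<lbrakk>h \<notin> R; b \<in> D h\<rbrakk> \<Longrightarrow> L0 h =
      (if (\<exists>x\<in>D h. r x = X) \<or> (\<forall>v\<in>D h - {b}. r v \<noteq> Y \<and> (\<forall>x\<in>V. r x = X \<longrightarrow> \<not> Q v x))
       then {1, 3} else {2, 3})"
    unfolding L0_def using assms by simp_all
qed

lemma S_3:
  assumes "h \<in> S"
  shows "3 \<in> L0 h"
proof -
  have h: "h \<notin> R" "h \<notin> \<Lambda>" using assms R_Bad Lam_Bad Bad_not_S by blast+
  show ?thesis
  proof (cases rule: size_cases[of h])
    case (2 v)
    then have "r v = T \<or> v = b" using assms by (auto simp: S_def)
    then show ?thesis using L0_single[OF 2 h(1)] hub[OF hub_in] by auto
  next
    case 3
    then have "\<not> 3 \<le> card (D h)" "\<nexists>t. D h = {t}" by auto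
    then have "b \<in> D h" using assms unfolding S_def by blast
    then show ?thesis using L0_hub[OF 3 h(2,1)] by simp
  qed (use assms in \<open>simp_all add: S_def L0_big\<close>)
qed

lemma R_3:
  assumes "h \<in> R"
  shows "3 \<in> L0 h"
proof -
  have "h \<notin> \<Lambda>" "h \<in> Bad" using assms R_Lam R_Bad by blast+
  show ?thesis
  proof (cases rule: Bad_pair_or_single[OF \<open>h \<in> Bad\<close>])
    case (1 v)
    then show ?thesis using L0_R_single assms by simp
  next
    case 2
    then show ?thesis using L0_R_pair[OF 2 \<open>h \<notin> \<Lambda>\<close> assms] by simp
  qed
qed

lemma seen_common:
  assumes "h \<in> U" "card (D h) \<le> 2"
  obtains u k where "u \<in> V" "\<And>d. d \<in> D h \<Longrightarrow> Q d u" "A h k" "u \<in> D k"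
proof -
  have "\<exists>u\<in>V. \<forall>d\<in>D h. Q d u"
  proof (cases rule: size_cases[of h])
    case (2 v)
    then show ?thesis using common[of v v] D_sub[of h] by auto
  next
    case 3
    then obtain x y where "D h = {x, y}" by (auto simp: card_2_iff)
    then show ?thesis using common[of x y] D_sub[of h] by auto
  qed (use common hub_in D_sub[of h] assms in auto)
  then show thesis using sees[OF assms(1)] that by blast
qed

lemma pair_has_outer:
  assumes "h \<in> Bad"
  obtains z where "z \<in> D h" "z \<noteq> b" "\<not> Q b z"
proof -
  have "b \<notin> D h" using assms hub_S by (auto simp: Bad_def)
  then show thesis using Bad_hub[OF assms] that Q_sym by metis
qed

text \<open>Since \<open>z\<close> is neither \<open>X\<close> nor \<open>Y\<close>, a bad pair
  cannot hold both of these roles.\<close>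

lemma Bad_pair:
  assumes "h \<in> Bad" "card (D h) = 2"
  shows "\<exists>z w. D h = {z, w} \<and> z \<noteq> w \<and> \<not> Q b z \<and> z \<in> V \<and> w \<in> V"
proof -
  obtain z where z: "z \<in> D h" "\<not> Q b z" using pair_has_outer[OF assms(1)] by blast
  obtain x y where "D h = {x, y}" "x \<noteq> y" using assms(2) by (auto simp: card_2_iff)
  with z D_sub[of h] show ?thesis by (metis insert_commute insertE insert_subset singletonD)
qed

lemma not_hub_nbr: "\<lbrakk>z \<in> V; \<not> Q b z\<rbrakk> \<Longrightarrow> r z \<noteq> X \<and> r z \<noteq> Y"
  using hub_adj by blast

text \<open>A neighbour of \<open>h\<close> avoids \<open>S\<close> as \<open>h\<close> is bad,
  \<open>R\<close> by independence, and \<Lambda> by its definition, so only the default labels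
  remain.\<close>

lemma R_pair_nbr:
  assumes "h \<in> R" "A h k" "D k \<noteq> {}" "card (D h) = 2"
  shows "L0 k = {1, 2} \<and> card (D k) = 2 \<or>
    (\<exists>v. D k = {v} \<and> L0 k = {colour (r v)} \<and> r v \<noteq> T \<and> r v \<noteq> Hub)"
proof -
  have hB: "h \<in> Bad" using assms R_Bad by blast
  have kU: "k \<in> U" using assms A_U2 by blast
  have k: "k \<notin> S" "k \<notin> R" using Bad_nbr hB assms R_indep by blast+
  have "k \<notin> \<Lambda>" using Lam_R assms A_sym by blast
  show ?thesis
  proof (cases rule: size_cases[of k])
    case (2 v)
    have "v \<in> V" using 2 D_sub by blast
    then have "r v \<noteq> T" "r v \<noteq> Hub" using k kU 2 hub by (auto simp: S_def)
    then show ?thesis using L0_single 2 k by blast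
  next
    case 3
    have "b \<notin> D k" using hub_S kU k by blast
    then show ?thesis using L0_full[OF 3 \<open>k \<notin> \<Lambda>\<close> k(2)] 3 by blast
  qed (use assms k kU in \<open>auto simp: S_def\<close>)
qed

text \<open>Members of \<open>R\<close> are not stuck, so some neighbour is nonempty and not a
  single \<open>Y\<close> or \<open>NX\<close>; it carries 1. Hence \<open>L0\<close> picks 2 and 3
  for \<open>h\<close>.\<close>

lemma R_pair_seen1:
  assumes "h \<in> R" "y \<in> D h" "r y = Y" "card (D h) = 2"
  shows "seen1 h" "\<And>x. x \<in> D h \<Longrightarrow> r x \<noteq> X"
proof -
  have hB: "h \<in> Bad" "h \<notin> Stuck" using assms R_sub by blast+
  then obtain k where k: "A h k" "D k \<noteq> {}" "\<And>v. D k = {v} \<Longrightarrow> r v \<noteq> Y \<and> r v \<noteq> NX"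
    using assms unfolding Stuck_def by blast
  from R_pair_nbr[OF assms(1) k(1,2) assms(4)] show "seen1 h"
    unfolding seen1_def using k by (metis role.exhaust)
  obtain z w where "D h = {z, w}" "\<not> Q b z" "z \<in> V" using Bad_pair hB assms by blast
  then show "r x \<noteq> X" if "x \<in> D h" for x
    using not_hub_nbr that assms by auto
qed

text \<open>One vertex of the pair has role \<open>Y\<close>, the other is not
  \<open>Q\<close>-adjacent to the hub. So relabelling \<Lambda> never disturbs what an
  \<open>X\<close> guarantees.\<close>

lemma Lam_no_X: "\<lbrakk>h \<in> \<Lambda>; x \<in> D h\<rbrakk> \<Longrightarrow> r x \<noteq> X"
proof
  assume h: "h \<in> \<Lambda>" "x \<in> D h" "r x = X"
  then have B: "h \<in> Bad" "card (D h) = 2" "\<exists>y\<in>D h. r y = Y"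
    using Lam_Stuck by (auto simp: Stuck_def)
  obtain z w where zw: "D h = {z, w}" "\<not> Q b z" "z \<in> V" using Bad_pair B by blast
  then have "r z \<noteq> X" "r z \<noteq> Y" using not_hub_nbr by auto
  then show False using zw B(3) h(2,3) by auto
qed

section \<open>Labels guaranteed by the roles in a fibre\<close>

lemma X_rel:
  assumes "h \<in> U" "x \<in> D h" "r x = X"
  shows "1 \<in> L0 h"
proof (cases rule: size_cases[of h])
  case (2 v)
  have "h \<notin> R" using R_Bad Bad_single[of h v] 2 assms by auto
  then show ?thesis using L0_single 2 assms by auto
next
  case 3
  have "h \<notin> \<Lambda>" using Lam_no_X assms by blast
  have X: "\<exists>x\<in>D h. r x = X" using assms by blast
  show ?thesis
    using L0_R_pair[OF 3 \<open>h \<notin> \<Lambda>\<close>] L0_full[OF 3 \<open>h \<notin> \<Lambda>\<close>] L0_hub[OF 3 \<open>h \<notin> \<Lambda>\<close>] X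
    by (cases "h \<in> R"; cases "b \<in> D h") simp_all
qed (use assms in \<open>simp_all add: L0_big\<close>)

lemma hub_pair:
  assumes "card (D h) = 2" "b \<in> D h"
  obtains v where "D h = {b, v}" "v \<noteq> b" "v \<in> V" "r v \<noteq> Hub"
proof -
  obtain x y where xy: "D h = {x, y}" "x \<noteq> y" using assms by (auto simp: card_2_iff)
  with assms obtain v where v: "D h = {b, v}" "v \<noteq> b" by (cases "x = b") auto
  then have "v \<in> V" using D_sub[of h] by auto
  with v show thesis using that hub by blast
qed

lemma L0_hub_pair:
  assumes "h \<in> U" "D h = {b, v}" "v \<noteq> b"
  shows "L0 h = (if r v = X \<or> r v \<noteq> Y \<and> (\<forall>x\<in>V. r x = X \<longrightarrow> \<not> Q v x) then {1, 3} else {2, 3})"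
proof -
  have "h \<in> S" using hub_S assms by blast
  then have "h \<notin> R" "h \<notin> \<Lambda>" using R_Bad Lam_Bad Bad_not_S by blast+
  moreover have "card (D h) = 2" "b \<in> D h" using assms by auto
  moreover have "r b \<noteq> X" "D h - {b} = {v}" using assms hub[OF hub_in] by auto
  ultimately show ?thesis using L0_hub[of h] by (simp add: assms(2))
qed

text \<open>Pairs in \<open>R\<close> rest on \<open>R_pair_seen1\<close>; the hub paired with a
  \<open>Y\<close> gets 2 and 3.\<close>

lemma Y_rel:
  assumes "h \<in> U" "y \<in> D h" "r y = Y" "h \<notin> \<Lambda>"
  shows "2 \<in> L0 h"
proof (cases rule: size_cases[of h])
  case (2 v)
  have "h \<notin> R" using R_Bad Bad_single[of h v] 2 assms by auto
  then show ?thesis using L0_single 2 assms by auto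
next
  case 3
  show ?thesis
  proof (cases "h \<in> R")
    case True
    have "\<not> (\<exists>x\<in>D h. r x = X)" "seen1 h" using R_pair_seen1[OF True assms(2,3) 3] by blast+
    then show ?thesis using L0_R_pair[OF 3 assms(4) True] by simp
  next
    case False
    show ?thesis
    proof (cases "b \<in> D h")
      case True
      have "y \<noteq> b" using assms hub[OF hub_in] by auto
      then have D: "D h = {b, y}" using 3 True assms by (auto simp: card_2_iff)
      then show ?thesis
        using L0_hub_pair[OF assms(1) D \<open>y \<noteq> b\<close>] assms(3) by simp
    next
      case nb: False
      then show ?thesis using L0_full[OF 3 assms(4) False] by simp
    qed
  qed
qed (use assms in \<open>simp_all add: L0_big\<close>)

text \<open>Only bad singles can lose their colour to \<open>R\<close>. Paired with the hub,
  \<open>n\<close> has a \<open>Q\<close>-neighbour of role \<open>X\<close>, which selects 2 and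
  3.\<close>

lemma NX_rel:
  assumes "h \<in> U" "n \<in> D h" "r n = NX" "h \<notin> Bad"
  shows "2 \<in> L0 h"
proof (cases rule: size_cases[of h])
  case (2 v)
  have "h \<notin> R" using R_Bad assms by blast
  then show ?thesis using L0_single[OF 2] 2 assms by auto
next
  case 3
  have "h \<notin> R" "h \<notin> \<Lambda>" using assms R_Bad Lam_Bad by blast+
  show ?thesis
  proof (cases "b \<in> D h")
    case True
    then obtain v where v: "D h = {b, v}" "v \<noteq> b" "v \<in> V" using hub_pair 3 by blast
    then have "n = v" using assms hub[OF hub_in] by auto
    then show ?thesis using L0_hub_pair[OF assms(1) v(1,2)] NX_X[OF v(3)] assms by auto
  next
    case False
    then show ?thesis using L0_full[OF 3 \<open>h \<notin> \<Lambda>\<close> \<open>h \<notin> R\<close>] by simp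
  qed
qed (use assms in \<open>simp_all add: L0_big\<close>)

text \<open>Paired with the hub, \<open>n\<close> has no \<open>Q\<close>-neighbour of role
  \<open>X\<close> by \<open>NY_X\<close>, which selects 1 and 3.\<close>

lemma NY_rel:
  assumes "h \<in> U" "n \<in> D h" "r n = NY" "h \<notin> Bad"
  shows "1 \<in> L0 h"
proof (cases rule: size_cases[of h])
  case (2 v)
  have "h \<notin> R" using R_Bad assms by blast
  then show ?thesis using L0_single[OF 2] 2 assms by auto
next
  case 3
  have "h \<notin> R" "h \<notin> \<Lambda>" using assms R_Bad Lam_Bad by blast+
  show ?thesis
  proof (cases "b \<in> D h")
    case True
    then obtain v where v: "D h = {b, v}" "v \<noteq> b" "v \<in> V" using hub_pair 3 by blast
    then have "n = v" using assms hub[OF hub_in] by auto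
    then show ?thesis using L0_hub_pair[OF assms(1) v(1,2)] NY_X[OF v(3)] assms by auto
  next
    case False
    then show ?thesis using L0_full[OF 3 \<open>h \<notin> \<Lambda>\<close> \<open>h \<notin> R\<close>] by simp
  qed
qed (use assms in \<open>simp_all add: L0_big\<close>)

section \<open>Labels seen without relying on neighbours in \<Lambda>\<close>

text \<open>Labels of neighbours in \<open>\<Lambda>\<close> are not counted, since they are going to change.\<close>

definition covered :: "'h \<Rightarrow> nat \<Rightarrow> bool" where
  "covered h i \<longleftrightarrow> i \<in> L0 h \<or> (\<exists>k. A h k \<and> k \<notin> \<Lambda> \<and> i \<in> L0 k)"

lemma covered_self: "i \<in> L0 h \<Longrightarrow> covered h i"
  by (simp add: covered_def)

lemma coveredI: "\<lbrakk>A h k; k \<notin> \<Lambda>; i \<in> L0 k\<rbrakk> \<Longrightarrow> covered h i"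
  by (auto simp: covered_def)

lemma covered_X: "\<lbrakk>A h k; x \<in> D k; r x = X\<rbrakk> \<Longrightarrow> covered h 1"
  by (rule coveredI, assumption, metis Lam_no_X, rule X_rel[OF A_U2])

lemma covered_Y: "\<lbrakk>A h k; y \<in> D k; r y = Y; k \<notin> \<Lambda>\<rbrakk> \<Longrightarrow> covered h 2"
  by (rule coveredI, assumption, assumption, rule Y_rel[OF A_U2])

lemma S_not_Lam: "h \<in> S \<Longrightarrow> h \<notin> \<Lambda>"
  using Lam_Bad Bad_not_S by blast

lemma covered_S: "\<lbrakk>A h k; k \<in> S\<rbrakk> \<Longrightarrow> covered h 3"
  by (rule coveredI, assumption, rule S_not_Lam, assumption, rule S_3)

lemma covered_hub: "\<lbrakk>A h k; b \<in> D k\<rbrakk> \<Longrightarrow> covered h 3"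
  by (rule covered_S, assumption, rule hub_S[OF A_U2])

lemma covered_R: "\<lbrakk>A h k; k \<in> R\<rbrakk> \<Longrightarrow> covered h 3"
  by (rule coveredI, assumption, use R_Lam in blast, rule R_3)

text \<open>A bad \<open>h\<close> has a neighbour in \<open>R\<close>: by maximality if it is not
  stuck, by the definition of \<Lambda> if it is.\<close>

lemma covered_3:
  assumes "h \<in> U" "D h \<noteq> {}" "h \<notin> R" "h \<notin> \<Lambda>"
  shows "covered h 3"
proof (cases "h \<in> Bad")
  case True
  then have "\<exists>k\<in>R. A h k" using R_dom assms unfolding \<Lambda>_def by blast
  then show ?thesis using covered_R by blast
next
  case False
  then have "h \<in> S \<or> (\<exists>k\<in>S. A h k)" using assms by (auto simp: Bad_def)
  then show ?thesis using covered_S S_3 by (auto simp: covered_def)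
qed

text \<open>\<open>sees\<close> applies vacuously, so every vertex of \<open>G\<close> occurs next
  to \<open>h\<close>. The label 2 can fail because the vertices of role \<open>Y\<close> may occur
  only in \<Lambda>.\<close>

lemma covered_empty:
  assumes "h \<in> U" "D h = {}"
  shows "covered h 1" "covered h 3"
proof -
  obtain w where "w \<in> V" "r w = X" using common[OF hub_in hub_in] hub_adj Y_X by metis
  then show "covered h 1" using sees[of h w] assms covered_X by blast
  show "covered h 3" using sees[of h b] assms covered_hub hub_in by blast
qed

lemma Lam_nbr:
  assumes "h \<in> \<Lambda>" "A h k"
  shows "D k = {} \<or> (\<exists>v. D k = {v} \<and> (r v = Y \<or> r v = NX))"
  using assms Lam_Stuck by (auto simp: Stuck_def)

text \<open>The colouring at work: \<open>v\<close> has \<open>Q\<close>-neighbours of the missing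
  colours, and these occur in neighbouring fibres.\<close>

lemma covered_single:
  assumes h: "h \<in> U" "D h = {v}" "h \<notin> R"
  shows "covered h 1" "covered h 2"
proof -
  have v: "v \<in> V" using D_sub h by blast
  have L: "L0 h = {colour (r v)}" using L0_single h by blast
  have see: "\<exists>k. A h k \<and> u \<in> D k" if "u \<in> V" "Q v u" for u
    using sees[of h u] h that by auto
  have lam: "k \<notin> \<Lambda>" if "A h k" "r v \<noteq> Y" "r v \<noteq> NX" for k
    using Lam_nbr[of k h] that A_sym h by auto
  have X1: "covered h 1" if "\<exists>u\<in>V. Q v u \<and> r u = X"
    using that see covered_X by blast
  have Y2: "covered h 2" if "\<exists>u\<in>V. Q v u \<and> r u = Y" "r v \<noteq> Y" "r v \<noteq> NX"
    using that see lam covered_Y by blast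
  \<comment> \<open>A single \<open>T\<close> puts \<open>h\<close> into \<open>S\<close>, so no
    neighbour is bad and \<open>NX\<close>, \<open>NY\<close> keep their labels there.\<close>
  have S: "k \<notin> Bad" if "A h k" "r v = T" for k
    using Bad_nbr[of k h] that A_sym h by (auto simp: S_def)
  have "covered h 1 \<and> covered h 2"
  proof (cases "r v")
    case Hub
    then have "v = b" using hub v by blast
    obtain x where x: "x \<in> V" "Q b x" "r x = X"
      using common[OF hub_in hub_in] hub_adj Y_X by metis
    moreover obtain y where y: "y \<in> V" "Q b y" "r y = Y"
      using X_Y x hub_adj by metis
    ultimately show ?thesis using X1 Y2 Hub \<open>v = b\<close> by auto
  next
    case X
    then show ?thesis using L X_Y[OF v] Y2 covered_self by auto
  next
    case Y
    then show ?thesis using L Y_X[OF v] X1 covered_self by auto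
  next
    case T
    obtain u where u: "u \<in> V" "Q v u" "r u = X \<or> r u = NY" using T_1 v T by blast
    obtain w where w: "w \<in> V" "Q v w" "r w = Y \<or> r w = NX" using T_2 v T by blast
    have "covered h 1"
      using u X1 see[of u] NY_rel S lam T coveredI A_U2 by (metis role.distinct)
    moreover have "covered h 2"
      using w Y2 see[of w] NX_rel S lam T coveredI A_U2 by (metis role.distinct)
    ultimately show ?thesis ..
  next
    case NX
    then show ?thesis using L NX_X[OF v] X1 covered_self by auto
  next
    case NY
    then show ?thesis using L NY_Y[OF v] Y2 covered_self by auto
  qed
  then show "covered h 1" "covered h 2" by auto
qed

text \<open>Some \<open>Q\<close>-neighbour \<open>t\<close> of \<open>v\<close> has role
  \<open>T\<close>. Its fibre lies outside \<open>S\<close>, hence is a pair, and carries 1 and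
  2.\<close>

lemma covered_R_single:
  assumes h: "h \<in> R" "D h = {v}"
  shows "covered h 1" "covered h 2"
proof -
  have hB: "h \<in> Bad" "h \<in> U" using h R_Bad Bad_U by blast+
  have v: "v \<in> V" using D_sub h by blast
  have "r v = NX \<or> r v = NY" using Bad_single hB(1) h by blast
  then obtain t where t: "t \<in> V" "Q v t" "r t = T" using NX_T NY_T v by blast
  then obtain k where k: "A h k" "t \<in> D k" using sees[of h t] hB h by auto
  have kS: "k \<notin> S" "k \<in> U" using Bad_nbr hB k A_U2 by blast+
  have "card (D k) = 2"
    using kS k t by (cases rule: size_cases[of k]) (auto simp: S_def)
  moreover have "k \<notin> R" "k \<notin> \<Lambda>" using R_indep h k Lam_R A_sym by blast+
  moreover have "b \<notin> D k" using hub_S kS by blast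
  ultimately have "L0 k = {1, 2}" using L0_full by blast
  then show "covered h 1" "covered h 2" using coveredI[OF k(1) \<open>k \<notin> \<Lambda>\<close>] by auto
qed

text \<open>If the pair holds an \<open>X\<close>, a common \<open>Q\<close>-neighbour
  \<open>u\<close> is neither \<open>X\<close> nor \<open>NY\<close>, so its fibre supplies 2.
  Otherwise either \<open>seen1\<close> supplies 1, or the fibre of \<open>u\<close> is a single of
  colour 2.\<close>

lemma covered_R_pair:
  assumes h: "h \<in> R" "card (D h) = 2"
  shows "covered h 1" "covered h 2"
proof -
  have hB: "h \<in> Bad" "h \<in> U" "h \<notin> \<Lambda>" using h R_Bad Bad_U R_Lam by blast+
  have L: "L0 h = (if (\<exists>x\<in>D h. r x = X) \<or> \<not> seen1 h then {1, 3} else {2, 3})"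
    by (rule L0_R_pair[OF h(2) hB(3) h(1)])
  obtain u k where u: "u \<in> V" "\<And>d. d \<in> D h \<Longrightarrow> Q d u" and k: "A h k" "u \<in> D k"
    using seen_common[of h] hB h by auto
  have lam: "k \<notin> \<Lambda>" if "A h k" for k using that h Lam_R A_sym by blast
  have nbr: "L0 k = {1, 2} \<and> card (D k) = 2 \<or>
    (\<exists>v. D k = {v} \<and> L0 k = {colour (r v)} \<and> r v \<noteq> T \<and> r v \<noteq> Hub)"
    using R_pair_nbr[OF h(1) k(1) _ h(2)] k(2) by blast
  have "covered h 1 \<and> covered h 2"
  proof (cases "\<exists>x\<in>D h. r x = X")
    case True
    then obtain x where x: "x \<in> D h" "r x = X" "x \<in> V" using D_sub by blast
    have "r u \<noteq> X" "r u \<noteq> NY" using x u X_indep NY_X[of u x] Q_sym by blast+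
    then have "2 \<in> L0 k" using nbr k(2) by (cases "r u") auto
    then have "covered h 2" using coveredI k(1) lam by blast
    moreover have "covered h 1" using L True by (intro covered_self) simp
    ultimately show ?thesis by simp
  next
    case noX: False
    show ?thesis
    proof (cases "seen1 h")
      case True
      then obtain k' where k': "A h k'" "card (D k') = 2 \<or> (\<exists>v. D k' = {v} \<and> (r v = X \<or> r v = NY))"
        unfolding seen1_def by blast
      then have "D k' \<noteq> {}" by auto
      from R_pair_nbr[OF h(1) k'(1) this h(2)] have "1 \<in> L0 k'" using k'(2) by auto
      then have "covered h 1" using coveredI k'(1) lam by blast
      moreover have "covered h 2" using L True noX by (intro covered_self) simp
      ultimately show ?thesis by simp
    next
      case False
      then have "card (D k) \<noteq> 2" "\<And>v. D k = {v} \<Longrightarrow> r v \<noteq> X \<and> r v \<noteq> NY"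
        using k(1) unfolding seen1_def by blast+
      then have "2 \<in> L0 k" using nbr by (metis colour.simps(3,5) insertI1 role.exhaust)
      then have "covered h 2" using coveredI k(1) lam by blast
      moreover have "covered h 1" using L False by (intro covered_self) simp
      ultimately show ?thesis by simp
    qed
  qed
  then show "covered h 1" "covered h 2" by auto
qed

text \<open>Only a pair \<open>{b, v}\<close> lacks 1 or 2. Common \<open>Q\<close>-neighbours of
  \<open>b\<close> and \<open>v\<close> have role \<open>X\<close> or \<open>Y\<close>, and the test
  in \<open>L0\<close> tells which role can supply the missing label.\<close>

lemma covered_pair:
  assumes h: "h \<in> U" "card (D h) = 2" "h \<notin> R" "h \<notin> \<Lambda>"
  shows "covered h 1" "covered h 2"
proof -
  have "covered h 1 \<and> covered h 2"
  proof (cases "b \<in> D h")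
    case False
    then show ?thesis using L0_full[OF h(2,4,3)] by (simp add: covered_def)
  next
    case True
    then obtain v where v: "D h = {b, v}" "v \<noteq> b" "v \<in> V" using hub_pair h by blast
    note L = L0_hub_pair[OF h(1) v(1,2)]
    have see: "\<exists>k. A h k \<and> u \<in> D k" if "u \<in> V" "Q v u" "r u = X \<or> r u = Y" for u
      using sees[of h u] h(1) that v hub_adj[of u] by auto
    have lam: "k \<notin> \<Lambda>" if "A h k" for k
      using that Lam_Bad Bad_nbr[of k h] A_sym hub_S h(1) True by blast
    obtain u where u: "u \<in> V" "Q v u" "r u = X \<or> r u = Y"
      using common[OF hub_in v(3)] hub_adj by blast
    have X1: "covered h 1" if "x \<in> V" "Q v x" "r x = X" for x
      using see[of x] that covered_X by blast
    have Y2: "covered h 2" if "x \<in> V" "Q v x" "r x = Y" for x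
      using see[of x] that covered_Y lam by blast
    show ?thesis
    proof (cases "r v = X \<or> r v \<noteq> Y \<and> (\<forall>x\<in>V. r x = X \<longrightarrow> \<not> Q v x)")
      case True
      then have "r u = Y" using u X_indep v(3) by blast
      then show ?thesis using L True Y2 u covered_self by auto
    next
      case False
      then have "covered h 1" using X1 Y_X v(3) by blast
      then show ?thesis using L False covered_self by auto
    qed
  qed
  then show "covered h 1" "covered h 2" by auto
qed

lemma covered_all:
  assumes "h \<in> U" "h \<notin> \<Lambda>" "i \<in> {1, 2, 3}" "D h = {} \<Longrightarrow> i \<noteq> 2"
  shows "covered h i"
proof (cases rule: size_cases[of h])
  case 1
  then show ?thesis using covered_empty[OF assms(1)] assms by auto
next
  case 4
  then show ?thesis using assms(3) by (simp add: covered_def L0_big)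
next
  case (2 v)
  have "covered h 3" using covered_3[of h] assms 2 R_3 covered_self by (cases "h \<in> R") auto
  moreover have "covered h 1" "covered h 2"
    using covered_single[of h v] covered_R_single[of h v] assms 2 by (cases "h \<in> R"; blast)+
  ultimately show ?thesis using assms by auto
next
  case 3
  have "D h \<noteq> {}" using 3 by auto
  then have "covered h 3" using covered_3[of h] assms R_3 covered_self by (cases "h \<in> R") auto
  moreover have "covered h 1" "covered h 2"
    using covered_pair[of h] covered_R_pair[of h] assms 3 by (cases "h \<in> R"; blast)+
  ultimately show ?thesis using assms by auto
qed

text \<open>A common \<open>Q\<close>-neighbour of the pair lies in a neighbouring single fibre of
  colour 2, which is outside \<open>R\<close> and so keeps its colour.\<close>

lemma Lam_seen:
  assumes "h \<in> \<Lambda>"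
  shows "covered h 2"
proof -
  have h: "h \<in> U" "card (D h) = 2" using assms Lam_Bad Bad_U Lam_Stuck by (auto simp: Stuck_def)
  have "\<exists>k. A h k \<and> D k \<noteq> {}" using seen_common[of h] h by (metis empty_iff order_refl)
  then obtain k where k: "A h k" "D k \<noteq> {}" by blast
  then obtain v where "D k = {v}" "r v = Y \<or> r v = NX" using Lam_nbr[OF assms k(1)] by auto
  moreover have "k \<notin> R" using Lam_R assms k by blast
  moreover have "k \<notin> \<Lambda>" using Lam_nbr[of k h] A_sym k(1) assms h(2) by auto
  ultimately show ?thesis using L0_single[of k v] coveredI[OF k(1), of 2] by auto
qed

lemma L0_sub: "L0 h \<subseteq> {1, 2, 3}"
proof -
  have "colour x \<in> {1, 2, 3}" for x by (cases x) auto
  then show ?thesis by (simp add: L0_def)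
qed

lemma L0_card: "card (L0 h) \<le> card (D h)"
proof (cases rule: size_cases[of h])
  case (2 v)
  then show ?thesis by (cases "h \<in> R") (simp_all add: L0_R_single L0_single)
next
  case 3
  then show ?thesis
    using L0_Lam[of h] L0_R_pair[OF 3] L0_full[OF 3] L0_hub[OF 3]
    by (cases "h \<in> \<Lambda>"; cases "h \<in> R"; cases "b \<in> D h") simp_all
qed (simp_all add: L0_big L0_empty)

section \<open>Repairing the empty fibres that miss 2\<close>

definition E :: "'h set" where
  "E = {e\<in>U. D e = {} \<and> \<not> covered e 2}"

text \<open>A vertex \<open>y\<close> of role \<open>Y\<close> is seen in some \<open>l\<close> in
  \<Lambda>. A common \<open>Q\<close>-neighbour \<open>u\<close> of \<open>D l\<close> is
  \<open>Y\<close> or \<open>NX\<close>, and \<open>NX\<close> is impossible next to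
  \<open>y\<close>; so \<open>u\<close> is also seen in \<Lambda>, but not in
  \<open>l\<close>.\<close>

lemma E_two:
  assumes "e \<in> E"
  shows "2 \<le> card {l\<in>\<Lambda>. A e l}"
proof -
  have e: "e \<in> U" "D e = {}" "\<not> covered e 2" using assms by (auto simp: E_def)
  obtain y where y: "y \<in> V" "r y = Y" using common[OF hub_in hub_in] hub_adj X_Y by metis
  obtain l where l: "A e l" "y \<in> D l" using sees[of e y] e y by auto
  then have lL: "l \<in> \<Lambda>" using covered_Y e y by blast
  then have lU: "l \<in> U" "card (D l) = 2" using Lam_Bad Bad_U Lam_Stuck by (auto simp: Stuck_def)
  obtain u k where u: "u \<in> V" "\<And>d. d \<in> D l \<Longrightarrow> Q d u" and k: "A l k" "u \<in> D k"
    using seen_common[of l] lU by auto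
  have "r u = Y \<or> r u = NX" using Lam_nbr[OF lL k(1)] k(2) by auto
  then have ruY: "r u = Y" using NX_Y[of u y] Q_sym[OF u(2)[OF l(2)]] u(1) y by blast
  obtain m where m: "A e m" "u \<in> D m" using sees[of e u] e u by auto
  then have mL: "m \<in> \<Lambda>" using covered_Y e ruY by blast
  have "m \<noteq> l" using u(2)[of u] m(2) Q_irrefl by metis
  have "finite \<Lambda>" using Lam_Bad Bad_U finU by (meson finite_subset subset_trans)
  then have "card {l, m} \<le> card {l\<in>\<Lambda>. A e l}"
    using l m lL mL by (intro card_mono) auto
  then show ?thesis using \<open>m \<noteq> l\<close> by auto
qed

theorem labelling:
  obtains L :: "'h \<Rightarrow> nat set" where
    "\<And>h i. \<lbrakk>h \<in> U; i \<in> {1, 2, 3}\<rbrakk> \<Longrightarrow> i \<in> L h \<or> (\<exists>k. A h k \<and> i \<in> L k)"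
    "\<And>h. L h \<subseteq> {1, 2, 3}"
    "(\<Sum>h\<in>U. card (L h)) \<le> (\<Sum>h\<in>U. card (D h))"
proof -
  define N where "N e = {l\<in>\<Lambda>. A e l}" for e
  have finL: "finite \<Lambda>" using Lam_Bad Bad_U finU by (meson finite_subset subset_trans)
  have "finite E" using finU by (auto simp: E_def)
  then obtain M where M: "M \<subseteq> E" "\<And>x y. \<lbrakk>x \<in> M; y \<in> M; x \<noteq> y\<rbrakk> \<Longrightarrow> N x \<inter> N y = {}"
      "\<And>x. \<lbrakk>x \<in> E; x \<notin> M\<rbrakk> \<Longrightarrow> \<exists>y\<in>M. N x \<inter> N y \<noteq> {}"
    using maximal_independent_subset[of E "\<lambda>x y. N x \<inter> N y \<noteq> {}"] by (metis inf_commute)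
  define P where "P = (\<Union>e\<in>M. N e)"
  define L where "L h = (if h \<in> M then {1, 3} else if h \<in> P then {2} else L0 h)" for h
  have MU: "M \<subseteq> U" "\<And>e. e \<in> M \<Longrightarrow> D e = {}" using M(1) by (auto simp: E_def)
  have PL: "P \<subseteq> \<Lambda>" by (auto simp: P_def N_def)
  have Lam2: "card (D l) = 2" "D l \<noteq> {}" if "l \<in> \<Lambda>" for l
    using that Lam_Stuck by (auto simp: Stuck_def)
  have disj: "M \<inter> \<Lambda> = {}" using MU Lam2 by blast
  have finM: "finite M" using MU finU finite_subset by blast
  have L0M: "L0 h = {}" if "h \<in> M" for h using MU that by (simp add: L0_empty)
  \<comment> \<open>Labels are lost only inside \<Lambda>, whose members \<open>covered\<close>
    ignores as neighbours.\<close>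
  have keep: "i \<in> L k" if "i \<in> L0 k" "k \<notin> \<Lambda>" for i k
    using that PL L0M by (auto simp: L_def)
  have nbr: "i \<in> L h \<or> (\<exists>k. A h k \<and> i \<in> L k)" if "covered h i" "h \<notin> \<Lambda>" for h i
    using that keep unfolding covered_def by blast
  \<comment> \<open>By maximality of \<open>M\<close>, each \<open>e\<close> in \<open>E\<close> has
    a neighbour in \<open>P\<close>, where it finds the label 2.\<close>
  have MP: "\<exists>l. A e l \<and> l \<in> P" if "e \<in> E" for e
  proof -
    have "N e \<noteq> {}" using E_two[OF that] unfolding N_def by (metis card.empty not_numeral_le_zero)
    then have "N e \<inter> P \<noteq> {}" using M(3)[OF that] unfolding P_def by (cases "e \<in> M") blast+
    then show ?thesis by (auto simp: N_def)
  qed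
  have P2: "2 \<in> L l" if "l \<in> P" for l using that disj PL by (auto simp: L_def)
  have "i \<in> L h \<or> (\<exists>k. A h k \<and> i \<in> L k)" if h: "h \<in> U" "i \<in> {1, 2, 3}" for h i
  proof (cases "h \<in> \<Lambda>")
    case False
    show ?thesis
    proof (cases "D h = {} \<and> i = 2")
      case True
      then show ?thesis using nbr[of h 2] False h MP[of h] P2 by (auto simp: E_def)
    next
      case nE: False
      then show ?thesis using covered_all[OF h(1) False h(2)] nbr False by blast
    qed
  next
    case lam: True
    then have "h \<notin> M" using disj by blast
    show ?thesis
    proof (cases "h \<in> P")
      case True
      then obtain e where "e \<in> M" "A e h" by (auto simp: P_def N_def)
      then show ?thesis using A_sym True h \<open>h \<notin> M\<close> by (auto simp: L_def)
    next
      case False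
      then have "L h = {1, 3}" using L0_Lam[OF lam] \<open>h \<notin> M\<close> by (simp add: L_def)
      moreover have "\<exists>k. A h k \<and> 2 \<in> L k"
        using Lam_seen[OF lam] L0_Lam[OF lam] keep by (auto simp: covered_def)
      ultimately show ?thesis using h by auto
    qed
  qed
  moreover have "L h \<subseteq> {1, 2, 3}" for h using L0_sub[of h] by (auto simp: L_def)
  moreover have "(\<Sum>h\<in>U. card (L h)) \<le> (\<Sum>h\<in>U. card (D h))"
  proof -
    have finP: "finite P" using PL finL finite_subset by blast
    have PU: "P \<subseteq> U" "M \<inter> P = {}" using PL Lam_Bad Bad_U disj by blast+
    have split: "sum f U = sum f (U - (M \<union> P)) + sum f M + sum f P" for f :: "'h \<Rightarrow> nat"
      using PU MU(1) finU finM finP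
      by (metis (no_types, lifting) Un_least add.assoc sum.subset_diff sum.union_disjoint)
    have "card P = (\<Sum>e\<in>M. card (N e))"
      unfolding P_def using finM M(2) finL by (intro card_UN_disjoint) (auto simp: N_def)
    moreover have "(\<Sum>e\<in>M. 2) \<le> (\<Sum>e\<in>M. card (N e))"
      using E_two M(1) unfolding N_def by (intro sum_mono) blast
    \<comment> \<open>The two labels given to each fibre in \<open>M\<close> are paid for by the one
      label saved on each fibre in \<open>P\<close>.\<close>
    ultimately have "2 * card M \<le> card P" by simp
    moreover have "(\<Sum>h\<in>M. card (L h)) = 2 * card M" "(\<Sum>h\<in>M. card (D h)) = 0"
      using MU by (simp_all add: L_def)
    moreover have "card (L h) = 1" if "h \<in> P" for h
      using that PU(2) by (auto simp: L_def)
    then have "(\<Sum>h\<in>P. card (L h)) = card P" by simp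
    moreover have "(\<Sum>h\<in>P. card (D h)) = 2 * card P"
      using Lam2 PL by (simp add: subset_iff)
    moreover have "(\<Sum>h\<in>U - (M \<union> P). card (L h)) \<le> (\<Sum>h\<in>U - (M \<union> P). card (D h))"
      by (intro sum_mono) (use L0_card in \<open>auto simp: L_def\<close>)
    ultimately show ?thesis using split[of "\<lambda>h. card (L h)"] split[of "\<lambda>h. card (D h)"] by linarith
  qed
  ultimately show thesis by (rule that)
qed

end

section \<open>Domination number three\<close>

theorem corollary2p7:
  fixes G :: "'a pair_pre_digraph" and H :: "'b pair_pre_digraph"
  assumes "pair_graph G" "connected G"
    and "pair_graph H" "connected H"
    and "domination_number G = 3"
  shows "domination_number (cartesian_product G H) \<ge> domination_number G * domination_number H"
proof -
  interpret G: pair_graph G by fact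
  interpret H: pair_graph H by fact
  interpret GH: pair_graph "cartesian_product G H"
    by (rule pair_graph_cartesian_product) fact+
  let ?V = "pverts G" and ?U = "pverts H"
  obtain F where F: "dominating (cartesian_product G H) F"
      "card F = domination_number (cartesian_product G H)"
    using GH.domination_number_attained by blast
  then have F_sub: "F \<subseteq> ?V \<times> ?U" by (simp add: dominating_def cartesian_product_def)
  have finF: "finite F" using F_sub finite_subset by fastforce
  define Q where "Q u v \<longleftrightarrow> u \<noteq> v \<and> (u, v) \<notin> parcs G" for u v
  define D where "D h = {g. (g, h) \<in> F}" for h
  have D_sub: "D h \<subseteq> ?V" for h using F_sub by (auto simp: D_def)
  have Q_sym: "Q u v \<Longrightarrow> Q v u" for u v
    using G.arcs_symmetric by (auto simp: Q_def)
  have Q_irrefl: "\<not> Q u u" for u by (simp add: Q_def)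
  have common: "\<exists>w\<in>?V. Q u w \<and> Q v w" if "u \<in> ?V" "v \<in> ?V" for u v
  proof (rule ccontr)
    assume "\<not> ?thesis"
    then have "dominating G {u, v}"
      using that G.in_arcsD2 unfolding dominating_def closed_nbhd_def Q_def by auto
    then have "3 \<le> card {u, v}" using domination_number_le assms(5) by metis
    moreover have "card {u, v} \<le> 2" by (simp add: card_insert_if)
    ultimately show False by simp
  qed
  have V: "finite ?V" "?V \<noteq> {}" using assms(2) by (auto simp: connected_def strongly_connected_def)
  obtain b r where "roles ?V Q b r"
    by (rule roles_exist[of ?V Q, OF V Q_sym Q_irrefl common])
  then interpret roles ?V Q b r .
  interpret role_product ?V Q b r ?U "\<lambda>h k. (h, k) \<in> parcs H" D
  proof
    show "finite (D h)" for h by (rule finite_subset[OF D_sub V(1)])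
    show "\<exists>k. (h, k) \<in> parcs H \<and> u \<in> D k"
      if h: "h \<in> ?U" "u \<in> ?V" and Q: "\<And>d. d \<in> D h \<Longrightarrow> Q d u" for h u
    proof -
      have "(u, h) \<in> (\<Union>p\<in>F. closed_nbhd (cartesian_product G H) p)"
        using F(1) h by (simp add: dominating_def cartesian_product_def)
      then obtain g k where gk: "(g, k) \<in> F" "(u, h) = (g, k) \<or> h = k \<and> (g, u) \<in> parcs G \<or>
          g = u \<and> (k, h) \<in> parcs H"
        by (auto simp: closed_nbhd_def cartesian_product_def)
      \<comment> \<open>Fibre elements are \<open>Q\<close>-adjacent to \<open>u\<close>, hence
        neither equal nor adjacent to it, so \<open>(g, k)\<close> lies in another copy of
        \<open>G\<close>.\<close>
      moreover have "Q g u" if "k = h" using Q gk(1) that by (simp add: D_def)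
      ultimately have "g = u" "(k, h) \<in> parcs H" by (auto simp: Q_def)
      then show ?thesis using gk(1) H.arcs_symmetric by (auto simp: D_def)
    qed
    show "(h, h) \<notin> parcs H" for h using H.no_loops[of "(h, h)"] by auto
  qed (use D_sub H.in_arcsD1 H.arcs_symmetric in auto)
  obtain L :: "'b \<Rightarrow> nat set" where
    L: "\<And>h i. \<lbrakk>h \<in> ?U; i \<in> {1, 2, 3}\<rbrakk> \<Longrightarrow> i \<in> L h \<or> (\<exists>k. (h, k) \<in> parcs H \<and> i \<in> L k)"
    and L_sub: "\<And>h. L h \<subseteq> {1, 2, 3}"
    and L_card: "(\<Sum>h\<in>?U. card (L h)) \<le> (\<Sum>h\<in>?U. card (D h))"
    using labelling by blast
  \<comment> \<open>Each label class dominates \<open>H\<close>; double counting then compares the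
    three classes with \<open>F\<close>.\<close>
  define P where "P i = {h\<in>?U. i \<in> L h}" for i
  have "domination_number H \<le> card (P i)" if "i \<in> {1, 2, 3}" for i
  proof (rule domination_number_le)
    have "\<exists>k\<in>P i. h \<in> closed_nbhd H k" if "h \<in> ?U" for h
      using L[OF that \<open>i \<in> {1, 2, 3}\<close>] that H.arcs_symmetric H.in_arcsD2
      unfolding P_def closed_nbhd_def by blast
    moreover have "closed_nbhd H k \<subseteq> ?U" if "k \<in> P i" for k
      using that H.in_arcsD2 by (auto simp: P_def closed_nbhd_def)
    ultimately show "dominating H (P i)"
      unfolding dominating_def by (auto simp: P_def)
  qed
  then have "(\<Sum>i\<in>{1, 2, 3::nat}. domination_number H) \<le> (\<Sum>i\<in>{1, 2, 3}. card (P i))"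
    by (intro sum_mono)
  also have "\<dots> = (\<Sum>h\<in>?U. card (L h))"
  proof -
    have "{i\<in>{1, 2, 3}. i \<in> L h} = L h" for h using L_sub by blast
    then show ?thesis
      using sum_multicount_gen[of "{1, 2, 3::nat}" ?U "\<lambda>i h. i \<in> L h" "\<lambda>h. card (L h)"]
      by (simp add: P_def)
  qed
  also note L_card
  also have "(\<Sum>h\<in>?U. card (D h)) = card F"
  proof -
    have "F = (\<Union>h\<in>?U. (\<lambda>g. (g, h)) ` D h)" using F_sub by (auto simp: D_def)
    moreover have "card (\<Union>h\<in>?U. (\<lambda>g. (g, h)) ` D h) = (\<Sum>h\<in>?U. card ((\<lambda>g. (g, h)) ` D h))"
      by (intro card_UN_disjoint) (auto simp: finD)
    ultimately show ?thesis by (simp add: card_image inj_on_def)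
  qed
  finally show ?thesis using F(2) assms(5) by simp
qed

end
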